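(* For any multiset of unit vectors $\omega_n=\{u_1,\dots,u_n\}\subset S^{d-1}$ (where $d,n\ge 1$), $$\max_{\varepsilon\in\{-1,1\}^n}\left|\sum_{i=1}^n\varepsilon_i u_i\right| = M^1(\omega_n).$$
   Context: $S^{d-1}$ is the Euclidean unit sphere in $\mathbb{R}^d$, $|\cdot|$ denotes the Euclidean norm of a vector (and absolute value of a scalar), and $\langle\cdot,\cdot\rangle$ is the standard inner product. For a multiset $\omega_n=\{u_1,\dots,u_n\}\subset S^{d-1}$ (repetitions allowed), $M^1(\omega_n)=\max_{v\in S^{d-1}}\sum_{i=1}^n|\langle v,u_i\rangle|$ is its $\ell_1$-polarization. *)

theory Defs
  imports "HOL-Analysis.Analysis" "HOL-Library.Multiset" "HOL-Library.FuncSet"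
begin

(* The maximum ranges over an infinite set, so Max does not apply.  GREATEST denotes the
   greatest attained value (not just a supremum) and is unspecified if there is none. *)
definition l1_polarization :: "(real ^ 'd) multiset \<Rightarrow> real" where
  "l1_polarization \<omega> =
     (GREATEST m. m \<in> (\<lambda>v. \<Sum>u\<in>#\<omega>. \<bar>v \<bullet> u\<bar>) ` sphere 0 1)"

(* Extensional functions, so that the set is finite: a copy of {-1,1}^n. *)
definition sign_vectors :: "nat \<Rightarrow> (nat \<Rightarrow> real) set" where
  "sign_vectors n = {1..n} \<rightarrow>\<^sub>E {- 1, 1}"

end

theory Submission
  imports Defs
begin

text \<open>
  For a unit vector \<open>v\<close>, the sum of the \<open>\<bar>v \<bullet> u i\<bar>\<close> is \<open>v \<bullet> (\<Sum>i. \<epsilon> i *\<^sub>R u i)\<close> with \<open>\<epsilon> i\<close> the sign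
  of \<open>v \<bullet> u i\<close>, so by Cauchy--Schwarz it is at most the left-hand side. Conversely, the direction of
  a longest signed sum attains this bound, so no compactness argument is needed.
\<close>

lemma finite_sign_vectors: "finite (sign_vectors n)"
  unfolding sign_vectors_def by (intro finite_PiE) auto

lemma sign_vectors_nonempty: "sign_vectors n \<noteq> {}"
  unfolding sign_vectors_def by (auto simp: PiE_eq_empty_iff)

lemma abs_sign_vectors: "\<epsilon> \<in> sign_vectors n \<Longrightarrow> i \<in> {1..n} \<Longrightarrow> \<bar>\<epsilon> i\<bar> = 1"
  unfolding sign_vectors_def by (auto dest: PiE_mem)

lemma sum_abs_inner_le_norm_signed_sum:
  fixes u :: "nat \<Rightarrow> 'a :: real_inner"
  assumes "norm v = 1"
  shows "\<exists>\<epsilon>\<in>sign_vectors n. (\<Sum>i=1..n. \<bar>v \<bullet> u i\<bar>) \<le> norm (\<Sum>i=1..n. \<epsilon> i *\<^sub>R u i)"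
proof -
  \<comment> \<open>Where \<open>v \<bullet> u i\<close> is zero the sign is set to 1:
    \<open>sgn\<close> would give 0, which is not an admissible sign. The restriction to
    \<open>{1..n}\<close> makes the function extensional.\<close>
  define \<epsilon> where "\<epsilon> = (\<lambda>i\<in>{1..n}. if v \<bullet> u i < 0 then - 1 else 1 :: real)"
  have "\<epsilon> \<in> sign_vectors n"
    unfolding \<epsilon>_def sign_vectors_def by auto
  moreover have "(\<Sum>i=1..n. \<bar>v \<bullet> u i\<bar>) = v \<bullet> (\<Sum>i=1..n. \<epsilon> i *\<^sub>R u i)"
    unfolding inner_sum_right by (intro sum.cong) (auto simp: \<epsilon>_def)
  moreover have "\<dots> \<le> norm (\<Sum>i=1..n. \<epsilon> i *\<^sub>R u i)"
    using norm_cauchy_schwarz[of v] assms by simp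
  ultimately show ?thesis by auto
qed

text \<open>Termwise: a real number is at most its absolute value, and a factor of modulus 1 does
  not change that absolute value.\<close>

lemma inner_signed_sum_le:
  fixes u :: "nat \<Rightarrow> 'a :: real_inner"
  assumes "\<epsilon> \<in> sign_vectors n"
  shows "v \<bullet> (\<Sum>i=1..n. \<epsilon> i *\<^sub>R u i) \<le> (\<Sum>i=1..n. \<bar>v \<bullet> u i\<bar>)"
  unfolding inner_sum_right
proof (rule sum_mono)
  fix i assume "i \<in> {1..n}"
  then have "\<bar>v \<bullet> \<epsilon> i *\<^sub>R u i\<bar> = \<bar>v \<bullet> u i\<bar>"
    using abs_sign_vectors[OF assms] by (simp add: abs_mult)
  then show "v \<bullet> \<epsilon> i *\<^sub>R u i \<le> \<bar>v \<bullet> u i\<bar>" by linarith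
qed

theorem proposition3:
  fixes \<omega> :: "(real ^ 'd) multiset" and u :: "nat \<Rightarrow> real ^ 'd" and n :: nat
  assumes "n \<ge> 1"
    and "\<omega> = image_mset u (mset_set {1..n})"
    and "set_mset \<omega> \<subseteq> sphere 0 1"
  shows "Max ((\<lambda>\<epsilon>. norm (\<Sum>i=1..n. \<epsilon> i *\<^sub>R u i)) ` sign_vectors n) = l1_polarization \<omega>"
proof -
  define S where "S = (\<lambda>\<epsilon>. \<Sum>i=1..n. \<epsilon> i *\<^sub>R u i)"
  define P where "P = (\<lambda>v. \<Sum>i=1..n. \<bar>v \<bullet> u i\<bar>)"
  define N where "N = Max ((\<lambda>\<epsilon>. norm (S \<epsilon>)) ` sign_vectors n)"
  have polarization: "(\<Sum>w\<in>#\<omega>. \<bar>v \<bullet> w\<bar>) = P v" for v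
    by (simp add: assms(2) P_def sum_unfold_sum_mset image_mset.compositionality comp_def)
  have norm_le_N: "norm (S \<epsilon>) \<le> N" if "\<epsilon> \<in> sign_vectors n" for \<epsilon>
    unfolding N_def using that finite_sign_vectors by (intro Max_ge) auto
  have P_le_N: "P v \<le> N" if "v \<in> sphere 0 1" for v
    using sum_abs_inner_le_norm_signed_sum[of v n u] norm_le_N that
    unfolding P_def S_def by fastforce
  have "N \<in> (\<lambda>\<epsilon>. norm (S \<epsilon>)) ` sign_vectors n"
    unfolding N_def using finite_sign_vectors sign_vectors_nonempty by (intro Max_in) auto
  then obtain \<epsilon> where \<epsilon>: "\<epsilon> \<in> sign_vectors n" "N = norm (S \<epsilon>)" by auto
  \<comment> \<open>\<open>sgn 0 = 0\<close> is not a unit vector; if all signed sums vanish, any unit vector will do.\<close>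
  define v where "v = (if S \<epsilon> = 0 then u 1 else sgn (S \<epsilon>))"
  \<comment> \<open>Here \<open>n \<ge> 1\<close> enters: it makes \<open>u 1\<close> an element of
    \<open>\<omega>\<close>, hence a unit vector.\<close>
  have "u 1 \<in> sphere 0 1"
    using assms by (intro subsetD[OF assms(3)]) simp
  then have "v \<in> sphere 0 1"
    unfolding v_def by (simp add: norm_sgn)
  \<comment> \<open>If \<open>S \<epsilon>\<close> vanishes, both sides are 0; otherwise the inner
    product of \<open>S \<epsilon>\<close> with its own direction is its norm.\<close>
  moreover have "N = v \<bullet> S \<epsilon>"
    unfolding v_def \<epsilon>(2)
    by (simp add: sgn_div_norm dot_square_norm power2_eq_square)
  then have "N \<le> P v"
    using inner_signed_sum_le[OF \<epsilon>(1), of v u] unfolding S_def P_def by simp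
  \<comment> \<open>The two bounds give \<open>N = P v\<close>, so the upper bound \<open>N\<close>
    is attained on the sphere. This also shows that the \<open>GREATEST\<close> in the definition
    exists.\<close>
  ultimately have "N \<in> P ` sphere 0 1"
    using P_le_N by (intro image_eqI[of _ _ v]) (auto intro: antisym)
  then have "(GREATEST m. m \<in> P ` sphere 0 1) = N"
    using P_le_N by (intro Greatest_equality) auto
  then show ?thesis
    by (simp add: l1_polarization_def polarization N_def S_def)
qed

end
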